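(* Let $a,b$ be nonzero real numbers. Then for all $n\ge 1$, $$\Psi_n\left(x;a,b,\tfrac{b^2}{4}\right)=a\,x\left(\frac b2\right)^{n-1}(n-1)!\;L_{n-1}^{(1)}\left(-\frac{2a}{b}x\right).$$
   Context: The polynomials $\Psi_n\left(x;a,b,\frac{b^2}{4}\right)$ are defined by the generating function $\exp[xf(z)]=\sum_{n=0}^\infty \Psi_n\left(x;a,b,\frac{b^2}{4}\right)\frac{z^n}{n!}$ with $$f(z)=-\frac{2a}{b}\,\frac{\frac b2 z}{\frac b2 z-1}.$$ (This is the limit as $c\to b^2/4$ of $f(z)=\frac{a}{\sqrt{b^2-4c}}\ln\left[\frac{1-zR^-}{1-zR^+}\right]$, $R^\pm=\frac12[b\pm\sqrt{b^2-4c}]$, which defines $\Psi_n(x;a,b,c)$ in general.) The Laguerre polynomials are $L_n^{(\alpha)}(x)=\frac{(\alpha+1)_n}{n!}\,{}_1F_1\left(-n;\alpha+1;x\right)$, where $(\cdot)_n$ is the Pochhammer symbol. *)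

theory Defs
  imports "HOL-Analysis.FPS_Convergence"
begin

definition Psi_arg :: "real \<Rightarrow> real \<Rightarrow> real fps" where
  "Psi_arg a b =
     fps_const (- (2 * a / b)) *
       (fps_const (b / 2) * fps_X / (fps_const (b / 2) * fps_X - 1))"

(* The generating function is read as a formal power series in z, for each value of x. The
   composition expands exp (x f(z)) as the sum of (x f(z))^k / k!, which is meaningful because
   f has zero constant term. The third parameter b^2/4 is determined by b and not repeated. *)
definition Psi :: "nat \<Rightarrow> real \<Rightarrow> real \<Rightarrow> real \<Rightarrow> real" where
  "Psi n x a b = fact n * fps_nth (fps_exp 1 oo (fps_const x * Psi_arg a b)) n"

lemma Psi_arg_nth_0: "fps_nth (Psi_arg a b) 0 = 0"
  by (simp add: Psi_arg_def fps_divide_unit)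

lemma Psi_generating_function:
  "Abs_fps (\<lambda>n. Psi n x a b / fact n) = fps_exp 1 oo (fps_const x * Psi_arg a b)"
  by (simp add: fps_eq_iff Psi_def)

definition hyp_1F1 :: "real \<Rightarrow> real \<Rightarrow> real \<Rightarrow> real" where
  "hyp_1F1 p q x = eval_fps (fps_hypergeo [p] [q] 1) x"

lemma hyp_1F1_series:
  "hyp_1F1 p q x = (\<Sum>k. pochhammer p k / (pochhammer q k * fact k) * x ^ k)"
  by (simp add: hyp_1F1_def eval_fps_def)

(* Genuine Laguerre polynomial only when alpha is not a negative integer: otherwise the
   denominators of 1F1 may vanish and division by zero yields 0. *)
definition laguerre :: "nat \<Rightarrow> real \<Rightarrow> real \<Rightarrow> real" where
  "laguerre n \<alpha> x =
     pochhammer (\<alpha> + 1) n / fact n * hyp_1F1 (- real n) (\<alpha> + 1) x"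

end

theory Submission
  imports Defs
begin

text \<open>
  With \<open>c = b/2\<close> the series \<open>f\<close> equals \<open>a g\<close> where \<open>g = z/(1 - cz)\<close>. The relation
  \<open>g = z + c z g\<close> gives a Pascal-type recurrence for the coefficients of the powers of \<open>g\<close>,
  namely \<open>[z\<^sup>n] g\<^sup>k = binom (n-1) (k-1) c\<^sup>n\<^sup>-\<^sup>k\<close> for \<open>n, k \<ge> 1\<close>, so that
  \<open>\<Psi>\<^sub>n\<close> is an explicit finite sum, to be matched term by term with the hypergeometric one.
\<close>

text \<open>Assuming only the fixed-point equation for \<open>g\<close> avoids inverses, so any
  commutative ring will do. For \<open>k > n\<close> the truncated \<open>n - k\<close> is harmless,
  since the binomial vanishes.\<close>

lemma fps_nth_power_geometric:
  fixes g :: "'a::comm_ring_1 fps"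
  assumes g: "g = fps_X + fps_const c * fps_X * g"
  shows "fps_nth (g ^ Suc k) (Suc n) = of_nat (n choose k) * c ^ (n - k)"
proof -
  have g0: "fps_nth g 0 = 0"
    by (subst g) simp
  have rec: "fps_nth (g ^ Suc k) (Suc n) = fps_nth (g ^ k) n + c * fps_nth (g ^ Suc k) n" for k n
  proof -
    have "g ^ Suc k = (fps_X + fps_const c * fps_X * g) * g ^ k"
      by (simp flip: g)
    also have "\<dots> = fps_X * (g ^ k + fps_const c * g ^ Suc k)"
      by (simp add: algebra_simps)
    finally have "fps_nth (g ^ Suc k) (Suc n)
        = fps_nth (fps_X * (g ^ k + fps_const c * g ^ Suc k)) (Suc n)"
      by simp
    then show ?thesis
      by (simp only: fps_X_mult_nth) simp
  qed
  show ?thesis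
  \<comment> \<open>\<open>k\<close> must vary: \<open>rec\<close> refers to the exponents
    \<open>k\<close> and \<open>Suc k\<close> alike.\<close>
  proof (induction n arbitrary: k)
    case 0
    then show ?case
      by (subst rec) (cases k; simp add: g0)
  next
    case (Suc n)
    show ?case
    proof (cases k)
      case 0
      then show ?thesis
        using Suc.IH[of 0] by (subst rec) simp
    next
      case k: (Suc j)
      \<comment> \<open>Aligns the exponents of \<open>c\<close> so that Pascal's rule applies; for
        \<open>k > n\<close> both sides are 0.\<close>
      have "c * (of_nat (n choose k) * c ^ (n - k)) = of_nat (n choose k) * c ^ (n - j)"
      proof (cases "k \<le> n")
        case True
        then have "n - j = Suc (n - k)"
          using k by simp
        then show ?thesis
          by (simp add: mult_ac)
      qed (simp add: binomial_eq_0)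
      then show ?thesis
        using Suc.IH[of j] Suc.IH[of k] by (subst rec) (simp add: k algebra_simps)
    qed
  qed
qed

lemma Psi_Suc:
  assumes "b \<noteq> 0"
  shows "Psi (Suc m) x a b =
    (\<Sum>k\<le>m. fact (Suc m) / fact (Suc k) * (a * x) ^ Suc k * (of_nat (m choose k) * (b / 2) ^ (m - k)))"
proof -
  define c where "c = b / 2"
  define g where "g = fps_X * inverse (1 - fps_const c * fps_X)"
  have c: "c \<noteq> 0"
    using assms by (simp add: c_def)
  have unit: "(1 - fps_const c * fps_X) * inverse (1 - fps_const c * fps_X) = 1"
    by (rule inverse_mult_eq_1') simp
  have "(1 - fps_const c * fps_X) * g = fps_X"
    using unit by (simp add: g_def mult.left_commute)
  then have g: "g = fps_X + fps_const c * fps_X * g"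
    by (simp add: algebra_simps)
  have "fps_const c * fps_X / (fps_const c * fps_X - 1)
      = fps_const c * fps_X * inverse (- (1 - fps_const c * fps_X))"
    by (simp add: fps_divide_unit)
  also have "\<dots> = - fps_const c * g"
    by (simp only: fps_inverse_minus) (simp add: g_def mult.assoc flip: fps_const_neg)
  finally have "Psi_arg a b = fps_const (- (a / c)) * (- fps_const c * g)"
    by (simp add: Psi_arg_def c_def)
  also have "\<dots> = fps_const a * g"
    using c by (simp flip: mult.assoc fps_const_neg)
  finally have "fps_const x * Psi_arg a b = fps_const (a * x) * g"
    by (simp add: mult_ac flip: fps_const_mult)
  then have "Psi (Suc m) x a b =
      fact (Suc m) * (\<Sum>k=0..Suc m. (a * x) ^ k / fact k * fps_nth (g ^ k) (Suc m))"
    by (simp add: Psi_def fps_compose_nth power_mult_distrib fps_const_power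
        del: fact_Suc sum.atLeast0_atMost_Suc)
  \<comment> \<open>The term for \<open>k = 0\<close> drops out: \<open>g ^ 0 = 1\<close> has no
    coefficient at \<open>Suc m\<close>.\<close>
  also have "\<dots> =
      fact (Suc m) * (\<Sum>k\<le>m. (a * x) ^ Suc k / fact (Suc k) * fps_nth (g ^ Suc k) (Suc m))"
    by (simp add: sum.atMost_Suc_shift atLeast0AtMost del: fact_Suc power_Suc sum.atMost_Suc)
  finally show ?thesis
    by (simp add: fps_nth_power_geometric[OF g] sum_distrib_left mult_ac c_def
        del: fact_Suc power_Suc)
qed

text \<open>The binomial factor vanishes for \<open>k > m\<close>, which makes the 1F1 series
  terminate; the factor \<open>fact k\<close> cancels the one in its denominator.\<close>

lemma pochhammer_neg_of_nat:
  "pochhammer (- of_nat m :: 'a::field_char_0) k = (- 1) ^ k * fact k * of_nat (m choose k)"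
  by (simp add: binomial_gbinomial gbinomial_pochhammer flip: mult.assoc power_mult_distrib)

lemma laguerre_one:
  "laguerre m 1 y = (\<Sum>k\<le>m. of_nat (Suc m) / fact (Suc k) * of_nat (m choose k) * (- y) ^ k)"
proof -
  \<comment> \<open>Both sides are the rising factorial of 1 of length \<open>Suc k\<close>, whose
    first factor is 1.\<close>
  have poch: "pochhammer 2 k = (fact (Suc k) :: real)" for k
    using pochhammer_rec[of "1 :: real" k] by (simp add: pochhammer_fact[symmetric] del: fact_Suc)
  have "hyp_1F1 (- real m) 2 y =
      (\<Sum>k\<le>m. pochhammer (- real m) k / (pochhammer 2 k * fact k) * y ^ k)"
    unfolding hyp_1F1_series
    by (rule suminf_finite) (auto simp: pochhammer_neg_of_nat binomial_eq_0)
  also have "\<dots> = (\<Sum>k\<le>m. of_nat (m choose k) * (- y) ^ k / fact (Suc k))"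
    by (rule sum.cong)
      (auto simp: pochhammer_neg_of_nat poch power_minus[of y] simp del: fact_Suc)
  finally show ?thesis
    by (simp add: laguerre_def poch sum_distrib_left mult_ac)
qed

theorem corollary10:
  fixes a b x :: real and n :: nat
  assumes "a \<noteq> 0" and "b \<noteq> 0" and "n \<ge> 1"
  shows "Psi n x a b =
    a * x * (b / 2) ^ (n - 1) * fact (n - 1) * laguerre (n - 1) 1 (- (2 * a / b) * x)"
proof -
  obtain m where n: "n = Suc m"
    using assms(3) by (cases n) auto
  \<comment> \<open>As \<open>a = (b / 2) * (2 * a / b)\<close>, each factor \<open>a\<close>
    supplies one of the \<open>k\<close> missing factors \<open>b / 2\<close>.\<close>
  have "(a * x) ^ k * (b / 2) ^ (m - k) = (b / 2) ^ m * (2 * a / b * x) ^ k" if "k \<le> m" for k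
  proof -
    have "(b / 2) ^ m = (b / 2) ^ (m - k) * (b / 2) ^ k"
      using that by (simp flip: power_add)
    moreover have "(b / 2) ^ k * (2 * a / b * x) ^ k = (a * x) ^ k"
      using assms(2) by (simp flip: power_mult_distrib)
    ultimately show ?thesis
      by (simp add: mult_ac)
  qed
  then have "fact (Suc m) / fact (Suc k) * (a * x) ^ Suc k * (of_nat (m choose k) * (b / 2) ^ (m - k))
      = a * x * (b / 2) ^ m * fact m *
        (of_nat (Suc m) / fact (Suc k) * of_nat (m choose k) * (- (- (2 * a / b) * x)) ^ k)"
    if "k \<le> m" for k
    using that by (simp add: fact_Suc[of m] mult_ac del: fact_Suc of_nat_Suc)
  then show ?thesis
    unfolding n diff_Suc_1 Psi_Suc[OF assms(2)] laguerre_one sum_distrib_left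
    by (intro sum.cong) simp_all
qed

end
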